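(* For each $n$ let $T_n$ be a labeled tree of size $n$ chosen uniformly at random. Then the behavior of the random variable $c_{\max}^{(k)}(T_n)$, with $k=k(n)$, as $n\to\infty$ can be described as follows: (1) (subcritical case) for $k = n-d$ with $d = \omega(\sqrt{n})$, we have $c_{\max}^{(k)}(T_n)/n \xrightarrow{p} 0$; (2) (supercritical case) for $k = n-d$ with $d = o(\sqrt{n})$, we have $c_{\max}^{(k)}(T_n)/n \xrightarrow{p} 1$; with high probability (i.e. with probability tending to $1$), there is one "giant" component whose size is asymptotically equal to $n$.
   Context: A labeled tree of size $n$ is an (unrooted) tree with vertex set $[n]=\{1,\dots,n\}$. For such a tree $T$ and $0\le k\le n$, $c_{\max}^{(k)}(T)$ denotes the size (number of vertices) of the largest connected component of the forest induced by the vertices with labels in $\{1,\dots,k\}$. Here $0\le d=d(n)\le n$; $d=\omega(\sqrt n)$ means $d/\sqrt n\to\infty$; $\xrightarrow{p}$ denotes convergence in probability. *)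

theory Defs
  imports "HOL-Probability.Probability" "HOL-Library.Landau_Symbols"
begin

text \<open>
  A finite simple undirected graph is given by its vertex set \<open>V\<close> and its set of edges, each
  edge being a two-element subset of \<open>V\<close>. (\<open>Graph_Theory\<close> models undirected graphs as symmetric
  digraphs, in which a back-and-forth arc pair already is a cycle, so its \<open>tree\<close> and \<open>forest\<close>
  are not the undirected notions.)
\<close>

definition simple_graph :: "'a set \<Rightarrow> 'a set set \<Rightarrow> bool" where
  "simple_graph V E \<longleftrightarrow> finite V \<and> (\<forall>e\<in>E. e \<subseteq> V \<and> card e = 2)"

definition adj :: "'a set set \<Rightarrow> ('a \<times> 'a) set" where
  "adj E = {(u, v). {u, v} \<in> E}"

definition connected_graph :: "'a set \<Rightarrow> 'a set set \<Rightarrow> bool" where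
  "connected_graph V E \<longleftrightarrow> V \<noteq> {} \<and> (\<forall>u\<in>V. \<forall>v\<in>V. (u, v) \<in> (adj E)\<^sup>*)"

definition is_cycle :: "'a set set \<Rightarrow> 'a list \<Rightarrow> bool" where
  "is_cycle E xs \<longleftrightarrow> length xs \<ge> 3 \<and> distinct xs \<and>
     successively (\<lambda>u v. {u, v} \<in> E) xs \<and> {last xs, hd xs} \<in> E"

definition is_tree :: "'a set \<Rightarrow> 'a set set \<Rightarrow> bool" where
  "is_tree V E \<longleftrightarrow> simple_graph V E \<and> connected_graph V E \<and> (\<nexists>xs. is_cycle E xs)"

text \<open>The vertex set \<open>{1..n}\<close> being fixed, a labeled tree of size \<open>n\<close> is its edge set.\<close>

definition labeled_trees :: "nat \<Rightarrow> nat set set set" where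
  "labeled_trees n = {E. is_tree {1..n} E}"

definition induced_edges :: "'a set set \<Rightarrow> 'a set \<Rightarrow> 'a set set" where
  "induced_edges E S = {e \<in> E. e \<subseteq> S}"

definition components_of_graph :: "'a set \<Rightarrow> 'a set set \<Rightarrow> 'a set set" where
  "components_of_graph V E = V // {(u, v) \<in> V \<times> V. (u, v) \<in> (adj E)\<^sup>*}"

definition low_components :: "nat \<Rightarrow> nat set set \<Rightarrow> nat set set" where
  "low_components k T = components_of_graph {1..k} (induced_edges T {1..k})"

text \<open>The \<open>insert 0\<close> only matters for \<open>k = 0\<close>, where there is no component at all.\<close>

definition c_max :: "nat \<Rightarrow> nat set set \<Rightarrow> nat" where
  "c_max k T = Max (insert 0 (card ` low_components k T))"

text \<open>Below, \<open>pmf_of_set\<close> is the uniform distribution only on finite nonempty sets.\<close>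

lemma finite_labeled_trees: "finite (labeled_trees n)"
proof (rule finite_subset)
  show "labeled_trees n \<subseteq> Pow (Pow {1..n})"
    by (auto simp: labeled_trees_def is_tree_def simple_graph_def)
qed simp

lemma labeled_trees_nonempty:
  assumes "n \<ge> 1"
  shows "labeled_trees n \<noteq> {}"
proof -
  define E where "E = (\<lambda>v. {1, v}) ` {2..n}"
  have "simple_graph {1..n} E"
    unfolding simple_graph_def
  proof (intro conjI ballI)
    fix e
    assume "e \<in> E"
    then obtain v where "v \<in> {2..n}" "e = {1, v}"
      unfolding E_def by blast
    then show "e \<subseteq> {1..n}" "card e = 2"
      by simp_all
  qed simp
  moreover have "connected_graph {1..n} E"
    unfolding connected_graph_def
  proof (intro conjI ballI)
    have edge: "{1, v} \<in> E" if "v \<in> {1..n}" "v \<noteq> 1" for v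
      unfolding E_def by (rule image_eqI[where x = v]) (use that in auto)
    have to: "(1, v) \<in> (adj E)\<^sup>*" if "v \<in> {1..n}" for v
    proof (cases "v = 1")
      case False
      then show ?thesis
        using edge[OF that] unfolding adj_def by (intro r_into_rtrancl) simp
    qed simp
    have from': "(v, 1) \<in> (adj E)\<^sup>*" if "v \<in> {1..n}" for v
    proof (cases "v = 1")
      case False
      then have "{v, 1} \<in> E"
        using edge[OF that] by (metis insert_commute)
      then show ?thesis
        unfolding adj_def by (intro r_into_rtrancl) simp
    qed simp
    show "(u, v) \<in> (adj E)\<^sup>*" if "u \<in> {1..n}" "v \<in> {1..n}" for u v
      using from'[OF that(1)] to[OF that(2)] by (rule rtrancl_trans)
  qed (use assms in auto)
  moreover have "\<not> is_cycle E xs" for xs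
  proof
    assume cyc: "is_cycle E xs"
    then have "length xs \<ge> 3"
      by (simp add: is_cycle_def)
    then obtain a b c ys where xs: "xs = a # b # c # ys"
      unfolding numeral_3_eq_3 Suc_le_length_iff by blast
    have one: "u = 1 \<or> v = 1" if "{u, v} \<in> E" for u v
    proof -
      from that obtain w where "{u, v} = {1, w}"
        unfolding E_def by blast
      then show ?thesis
        unfolding doubleton_eq_iff by blast
    qed
    have dist: "distinct xs" and ab: "{a, b} \<in> E" and bc: "{b, c} \<in> E"
      and closing: "{last (c # ys), a} \<in> E"
      using cyc unfolding is_cycle_def xs by simp_all
    have "last (c # ys) \<in> set (c # ys)"
      by (rule last_in_set) simp
    moreover have "a \<notin> set (c # ys)" "b \<notin> set (c # ys)" "a \<noteq> b" "c \<in> set (c # ys)"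
      using dist unfolding xs by simp_all
    ultimately show False
      using one[OF ab] one[OF bc] one[OF closing] by metis
  qed
  ultimately show ?thesis
    by (auto simp: labeled_trees_def is_tree_def)
qed

definition random_tree :: "nat \<Rightarrow> nat set set pmf" where
  "random_tree n = pmf_of_set (labeled_trees n)"

text \<open>
  Convergence in probability to a constant. The \<open>n\<close>-th random variable lives on its own
  discrete probability space.
\<close>

definition converges_in_prob :: "(nat \<Rightarrow> 'a pmf) \<Rightarrow> (nat \<Rightarrow> 'a \<Rightarrow> real) \<Rightarrow> real \<Rightarrow> bool" where
  "converges_in_prob M X c \<longleftrightarrow>
     (\<forall>\<epsilon>>0. (\<lambda>n. measure_pmf.prob (M n) {\<omega>. \<bar>X n \<omega> - c\<bar> > \<epsilon>}) \<longlonglongrightarrow> 0)"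

definition with_high_prob :: "(nat \<Rightarrow> 'a pmf) \<Rightarrow> (nat \<Rightarrow> 'a \<Rightarrow> bool) \<Rightarrow> bool" where
  "with_high_prob M P \<longleftrightarrow> (\<lambda>n. measure_pmf.prob (M n) {\<omega>. P n \<omega>}) \<longlonglongrightarrow> 1"

end

theory Submission
  imports Defs
begin

text \<open>
  Call the vertices in \<open>{1..k}\<close>, \<open>k = n - d\<close>, low, and let \<open>P\<close> be the number of ordered pairs of
  low vertices that are joined by a path of low vertices in the random tree. Then
  \<open>c_max\<^sup>2 \<le> P \<le> n * c_max\<close> (\<open>c_max_square_le\<close>, \<open>card_low_conn_le\<close>), so by Markov's inequality both
  parts of the theorem follow from bounds for the mean of \<open>P\<close>: it is \<open>o(n\<^sup>2)\<close> in the subcritical and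
  \<open>(1 - o(1)) n\<^sup>2\<close> in the supercritical case.

  The mean of \<open>P\<close> is found by exposing the path from \<open>u\<close> to \<open>v\<close> one vertex at a time. Rooted at \<open>u\<close>,
  a tree is an acyclic parent function (\<open>bij_betw_forests_trees\<close>). Once \<open>s\<close> vertices of the path are
  known, what remains unknown is a forest whose roots are these \<open>s\<close> vertices, and there are
  \<open>s n\<^bsup>n-s-1\<^esup>\<close> of those (\<open>card_forests\<close>). The path now either ends or is extended by one of the \<open>k - s\<close>
  other low vertices (\<open>path_count_rec\<close>). After normalisation this is the recursion
  \<open>W s = s + (k - s) / n * W (s + 1)\<close>, and the mean of \<open>P\<close> equals \<open>k * W 1\<close>
  (\<open>expectation_card_low_conn\<close>).

  Comparing the recursion with explicit super- and subsolutions gives \<open>W 1 \<le> (n / d)\<^sup>2\<close>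
  (\<open>path_mean_last_upper\<close>) and \<open>W 1 \<ge> n - d * (n / m + m)\<close> for \<open>1 \<le> m \<le> k\<close> (\<open>path_mean_last_lower\<close>).
  Hence \<open>c_max / n\<close> exceeds \<open>\<epsilon>\<close> with probability at most \<open>n / (\<epsilon> * d)\<^sup>2\<close>, and, with \<open>m\<close> near
  \<open>sqrt n\<close>, it stays below \<open>1 - \<epsilon>\<close> with probability \<open>O(d / (\<epsilon> * sqrt n))\<close>.
\<close>

section \<open>Counting rooted forests\<close>

text \<open>
  A forest on \<open>V\<close> with root set \<open>R\<close>, given by the parent of every other vertex. A rank that
  decreases along parents rules out cycles and forces every chain of parents to end in \<open>R\<close>;
  stating this with a rank, rather than with iterates of \<open>g\<close>, makes it easy to check after
  a surgery on the forest. Functions are extensional so that a forest is a single function.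
\<close>

definition forests :: "'a set \<Rightarrow> 'a set \<Rightarrow> ('a \<Rightarrow> 'a) set" where
  "forests V R = {g \<in> (V - R) \<rightarrow>\<^sub>E V. \<exists>\<delta> :: 'a \<Rightarrow> nat. \<forall>x\<in>V - R. \<delta> (g x) < \<delta> x}"

lemma finite_forests: "finite V \<Longrightarrow> finite (forests V R)"
  unfolding forests_def by (rule finite_subset[of _ "(V - R) \<rightarrow>\<^sub>E V"]) (auto intro: finite_PiE)

lemma forests_no_root:
  assumes "V \<noteq> {}"
  shows "forests V {} = {}"
proof (rule ccontr)
  assume "forests V {} \<noteq> {}"
  then obtain g and \<delta> :: "'a \<Rightarrow> nat" where g: "g \<in> V \<rightarrow>\<^sub>E V" and \<delta>: "\<And>x. x \<in> V \<Longrightarrow> \<delta> (g x) < \<delta> x"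
    unfolding forests_def by auto
  have "x \<notin> V" for x
  proof (induction "\<delta> x" arbitrary: x rule: less_induct)
    case less
    then show ?case using g \<delta> by (metis PiE_mem)
  qed
  with assms show False by auto
qed

text \<open>
  Promoting all of \<open>R\<close> to the bottom of a rank: a step that enters \<open>R\<close> is then always a decrease,
  so only the steps outside \<open>R\<close> have to be checked when a forest is reassembled.
\<close>

lemma rank_with_bottom:
  fixes \<delta> :: "'a \<Rightarrow> nat"
  assumes "\<And>x. x \<in> A \<Longrightarrow> g x \<in> R \<or> \<delta> (g x) < \<delta> x" and "A \<inter> R = {}"
  shows "\<exists>\<delta>' :: 'a \<Rightarrow> nat. \<forall>x\<in>A. \<delta>' (g x) < \<delta>' x"
  using assms by (intro exI[of _ "\<lambda>x. if x \<in> R then 0 else Suc (\<delta> x)"]) auto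

text \<open>
  Deleting a root \<open>r\<close> turns its set \<open>J\<close> of children into roots; conversely the forest is
  recovered from what remains by hanging every vertex of \<open>J\<close> below \<open>r\<close>.
\<close>

lemma bij_betw_forests_children:
  assumes "R \<subseteq> V" "r \<in> R" "J \<subseteq> V - R"
  shows "bij_betw (\<lambda>h x. if x \<in> J then r else h x) (forests (V - {r}) (R - {r} \<union> J))
    {g \<in> forests V R. {x \<in> V - R. g x = r} = J}"
proof (rule bij_betw_byWitness[where f' = "\<lambda>g. restrict g (V - R - J)"])
  let ?f = "\<lambda>h x. if x \<in> J then r else h x"
  let ?F = "forests (V - {r}) (R - {r} \<union> J)" and ?G = "{g \<in> forests V R. {x \<in> V - R. g x = r} = J}"
  have dom: "V - {r} - (R - {r} \<union> J) = V - R - J" using assms by auto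
  note F_def = forests_def[of "V - {r}" "R - {r} \<union> J", unfolded dom]
  show "\<forall>h\<in>?F. restrict (?f h) (V - R - J) = h"
    by (auto simp: F_def fun_eq_iff PiE_def extensional_def)
  show "\<forall>g\<in>?G. ?f (restrict g (V - R - J)) = g"
    by (auto simp: forests_def fun_eq_iff PiE_def extensional_def)
  show "?f ` ?F \<subseteq> ?G"
  proof safe
    fix h assume h: "h \<in> ?F"
    then obtain \<delta> :: "'a \<Rightarrow> nat" where ext: "h \<in> (V - R - J) \<rightarrow>\<^sub>E (V - {r})"
      and \<delta>: "\<And>x. x \<in> V - R - J \<Longrightarrow> \<delta> (h x) < \<delta> x"
      unfolding F_def by auto
    have "\<exists>\<delta>' :: 'a \<Rightarrow> nat. \<forall>x\<in>V - R. \<delta>' (?f h x) < \<delta>' x"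
      by (rule rank_with_bottom[where R = R and \<delta> = \<delta>]) (use assms \<delta> in auto)
    moreover have "?f h \<in> (V - R) \<rightarrow>\<^sub>E V"
      using ext assms by (auto simp: PiE_def extensional_def Pi_def)
    ultimately show "?f h \<in> forests V R" by (auto simp: forests_def)
    show "x \<in> J" if "x \<in> V" "x \<notin> R" "?f h x = r" for x
      using that ext by (auto simp: PiE_def Pi_def split: if_splits)
  qed (use assms in auto)
  show "(\<lambda>g. restrict g (V - R - J)) ` ?G \<subseteq> ?F"
  proof safe
    fix g assume g: "g \<in> forests V R" and J: "J = {x \<in> V - R. g x = r}"
    then obtain \<delta> :: "'a \<Rightarrow> nat" where ext: "g \<in> (V - R) \<rightarrow>\<^sub>E V"
      and \<delta>: "\<And>x. x \<in> V - R \<Longrightarrow> \<delta> (g x) < \<delta> x"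
      unfolding forests_def by auto
    have "restrict g (V - R - J) \<in> (V - R - J) \<rightarrow>\<^sub>E (V - {r})"
      using ext J by (auto simp: PiE_def Pi_def)
    then show "restrict g (V - R - {x \<in> V - R. g x = r}) \<in> forests (V - {r}) (R - {r} \<union> {x \<in> V - R. g x = r})"
      using \<delta> unfolding F_def[unfolded J] J by auto
  qed
qed

lemma card_forests_children:
  assumes "finite V" "R \<subseteq> V" "r \<in> R"
  shows "card (forests V R) = (\<Sum>J\<in>Pow (V - R). card (forests (V - {r}) (R - {r} \<union> J)))"
proof -
  let ?G = "\<lambda>J. {g \<in> forests V R. {x \<in> V - R. g x = r} = J}"
  have "forests V R = (\<Union>J\<in>Pow (V - R). ?G J)"
  proof (intro equalityI subsetI)
    fix g assume "g \<in> forests V R"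
    then show "g \<in> (\<Union>J\<in>Pow (V - R). ?G J)"
      by (intro UN_I[of "{x \<in> V - R. g x = r}"]) blast+
  qed simp
  also have "card \<dots> = (\<Sum>J\<in>Pow (V - R). card (?G J))"
    using assms finite_forests[OF assms(1)] by (intro card_UN_disjoint) auto
  also have "\<dots> = (\<Sum>J\<in>Pow (V - R). card (forests (V - {r}) (R - {r} \<union> J)))"
  proof (rule sum.cong)
    fix J assume "J \<in> Pow (V - R)"
    then have "bij_betw (\<lambda>h x. if x \<in> J then r else h x) (forests (V - {r}) (R - {r} \<union> J)) (?G J)"
      by (intro bij_betw_forests_children assms(2,3)) simp
    then show "card (?G J) = card (forests (V - {r}) (R - {r} \<union> J))"
      by (rule bij_betw_same_card[symmetric])
  qed simp
  finally show ?thesis .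
qed

text \<open>
  Grouping the subsets by size, this is the binomial theorem for \<open>(x + 1)\<^sup>m\<close> together with its
  derivative. The factor \<open>x + 1\<close> on the left avoids the exponent \<open>m - 1\<close>.
\<close>

lemma sum_Pow_weighted:
  fixes a x :: nat
  assumes "finite W"
  shows "Suc x * (\<Sum>J\<in>Pow W. (a + card J) * x ^ card (W - J)) = (a * Suc x + card W) * Suc x ^ card W"
  using assms
proof (induction W arbitrary: a rule: finite_induct)
  case empty
  then show ?case by simp
next
  case (insert w W)
  have inj: "inj_on (insert w) (Pow W)" using insert.hyps by (auto simp: inj_on_def)
  have fin: "J \<subseteq> W \<Longrightarrow> finite J" for J using insert.hyps finite_subset by auto
  have "(\<Sum>J\<in>Pow (insert w W). (a + card J) * x ^ card (insert w W - J)) =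
      (\<Sum>J\<in>Pow W. (a + card J) * x ^ card (insert w W - J)) +
      (\<Sum>J\<in>Pow W. (a + card (insert w J)) * x ^ card (insert w W - insert w J))"
    unfolding Pow_insert using insert.hyps
    by (subst sum.union_disjoint) (auto simp: sum.reindex[OF inj])
  also have "(\<Sum>J\<in>Pow W. (a + card J) * x ^ card (insert w W - J)) =
      (\<Sum>J\<in>Pow W. x * ((a + card J) * x ^ card (W - J)))"
  proof (intro sum.cong refl)
    fix J assume "J \<in> Pow W"
    then have "insert w W - J = insert w (W - J)" using insert.hyps by auto
    then show "(a + card J) * x ^ card (insert w W - J) = x * ((a + card J) * x ^ card (W - J))"
      using insert.hyps by simp
  qed
  also have "(\<Sum>J\<in>Pow W. (a + card (insert w J)) * x ^ card (insert w W - insert w J)) =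
      (\<Sum>J\<in>Pow W. (Suc a + card J) * x ^ card (W - J))"
  proof (intro sum.cong refl)
    fix J assume J: "J \<in> Pow W"
    then have "insert w W - insert w J = W - J" "w \<notin> J" using insert.hyps by auto
    then show "(a + card (insert w J)) * x ^ card (insert w W - insert w J) = (Suc a + card J) * x ^ card (W - J)"
      using fin J by simp
  qed
  finally have "Suc x * (\<Sum>J\<in>Pow (insert w W). (a + card J) * x ^ card (insert w W - J)) =
     x * (Suc x * (\<Sum>J\<in>Pow W. (a + card J) * x ^ card (W - J))) +
     Suc x * (\<Sum>J\<in>Pow W. (Suc a + card J) * x ^ card (W - J))"
    by (simp only: sum_distrib_left[symmetric] distrib_left[of _ _ "sum _ _"] mult.left_commute[of "Suc x" x])
  also have "\<dots> = x * ((a * Suc x + card W) * Suc x ^ card W) + (Suc a * Suc x + card W) * Suc x ^ card W"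
    unfolding insert.IH ..
  also have "\<dots> = (x * (a * Suc x + card W) + (Suc a * Suc x + card W)) * Suc x ^ card W"
    by (simp only: distrib_right mult.assoc)
  also have "x * (a * Suc x + card W) + (Suc a * Suc x + card W) = (a * Suc x + Suc (card W)) * Suc x"
    by (simp add: algebra_simps)
  also have "(a * Suc x + Suc (card W)) * Suc x * Suc x ^ card W = (a * Suc x + card (insert w W)) * Suc x ^ card (insert w W)"
    by (simp only: card_insert_disjoint[OF insert.hyps] power_Suc mult.assoc)
  finally show ?case .
qed

text \<open>
  Cayley's formula for forests with prescribed roots: \<open>s n\<^bsup>n-s-1\<^esup>\<close> of them for \<open>s\<close> roots among \<open>n\<close>
  vertices. It follows by removing one root and summing over its possible sets of children;
  the factor \<open>card V\<close> keeps the exponent nonnegative when every vertex is a root.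
\<close>

lemma card_forests:
  assumes "finite V" "R \<subseteq> V"
  shows "card V * card (forests V R) = card R * card V ^ card (V - R)"
  using assms
proof (induction "card V" arbitrary: V R)
  case 0
  then show ?case by auto
next
  case (Suc x V R)
  show ?case
  proof (cases "R = {}")
    case True
    moreover have "V \<noteq> {}" using Suc.hyps by auto
    ultimately show ?thesis by (simp add: forests_no_root)
  next
    case False
    then obtain r where r: "r \<in> R" by auto
    have cV': "card (V - {r}) = x" using Suc.prems Suc.hyps r by auto
    have finR: "finite R" using Suc.prems finite_subset by auto
    define a m where "a = card (R - {r})" and "m = card (V - R)"
    have cR: "card R = Suc a" unfolding a_def by (rule card.remove[OF finR r])
    have xam: "x = a + m"
    proof -
      have "card V = card R + m" unfolding m_def
        using card_Diff_subset[OF finR Suc.prems(2)] card_mono[OF Suc.prems] by simp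
      then show ?thesis using cR Suc.hyps by simp
    qed
    show ?thesis
    proof (cases "x = 0")
      case True
      then have "V = {r}" using cV' r Suc.prems by auto
      then have "R = V" using r Suc.prems by auto
      then have "forests V R = {\<lambda>_. undefined}" by (auto simp: forests_def)
      then show ?thesis using \<open>R = V\<close> by simp
    next
      case False
      have "x * (Suc x * card (forests V R)) = Suc x * (x * card (forests V R))" by (rule mult.left_commute)
      also have "x * card (forests V R) = (\<Sum>J\<in>Pow (V - R). x * card (forests (V - {r}) (R - {r} \<union> J)))"
        using card_forests_children[OF Suc.prems r] by (simp add: sum_distrib_left)
      also have "\<dots> = (\<Sum>J\<in>Pow (V - R). (a + card J) * x ^ card (V - R - J))"
      proof (intro sum.cong refl)
        fix J assume J: "J \<in> Pow (V - R)"
        have "card (V - {r}) * card (forests (V - {r}) (R - {r} \<union> J)) =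
            card (R - {r} \<union> J) * card (V - {r}) ^ card (V - {r} - (R - {r} \<union> J))"
          by (rule Suc.hyps(1)) (use cV' Suc.prems J r in auto)
        moreover have "V - {r} - (R - {r} \<union> J) = V - R - J" using r by auto
        moreover have "finite J" "(R - {r}) \<inter> J = {}" using J Suc.prems finite_subset[of J V] by auto
        then have "card (R - {r} \<union> J) = a + card J" using finR by (simp add: a_def card_Un_disjoint)
        ultimately show "x * card (forests (V - {r}) (R - {r} \<union> J)) = (a + card J) * x ^ card (V - R - J)"
          using cV' by simp
      qed
      also have "Suc x * \<dots> = (a * Suc x + m) * Suc x ^ m"
        unfolding m_def by (rule sum_Pow_weighted) (use Suc.prems in auto)
      also have "a * Suc x + m = x * Suc a" unfolding xam by (simp add: algebra_simps)
      finally have "x * (Suc x * card (forests V R)) = x * (Suc a * Suc x ^ m)" by (simp only: mult.assoc)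
      then have "Suc x * card (forests V R) = Suc a * Suc x ^ m" using False by (simp only: mult_cancel_left simp_thms)
      then show ?thesis unfolding cR m_def Suc.hyps(2)[symmetric] .
    qed
  qed
qed

lemma card_forests_power:
  assumes "finite V" "R \<subseteq> V"
  shows "real (card (forests V R)) * real (card V) ^ Suc (card R) = real (card R) * real (card V) ^ card V"
proof -
  have sum: "card (V - R) + card R = card V"
    using card_Diff_subset[OF finite_subset[OF assms(2,1)] assms(2)] card_mono[OF assms] by linarith
  have "card (forests V R) * card V ^ Suc (card R) = (card V * card (forests V R)) * card V ^ card R"
    by simp
  also have "\<dots> = card R * (card V ^ card (V - R) * card V ^ card R)"
    unfolding card_forests[OF assms] by (simp only: mult.assoc)
  also have "\<dots> = card R * card V ^ card V"
    unfolding power_add[symmetric] sum ..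
  finally have "real (card (forests V R) * card V ^ Suc (card R)) = real (card R * card V ^ card V)"
    by (rule arg_cong)
  then show ?thesis by (simp only: of_nat_mult of_nat_power)
qed

section \<open>Exposing a path inside a vertex set\<close>

text \<open>
  The vertices whose chain of parents leads to \<open>t\<close> with all vertices before \<open>t\<close> in \<open>A\<close>. For a tree
  rooted at \<open>t\<close> this will be the component of \<open>t\<close> in the subgraph induced by \<open>insert t A\<close>.
\<close>

inductive_set reach :: "('a \<Rightarrow> 'a) \<Rightarrow> 'a set \<Rightarrow> 'a \<Rightarrow> 'a set" for g A t where
  root: "t \<in> reach g A t"
| step: "x \<in> A \<Longrightarrow> g x \<in> reach g A t \<Longrightarrow> x \<in> reach g A t"

lemma reach_subset: "reach g A t \<subseteq> insert t A"
  by (auto elim: reach.cases)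

lemma reach_step_down:
  assumes "x \<in> reach g A t" "x \<noteq> t"
  shows "x \<in> A" "g x \<in> reach g A t"
  using assms by (auto elim: reach.cases)

lemma finite_reach: "finite A \<Longrightarrow> finite (reach g A t)"
  using reach_subset finite_subset by (metis finite_insert)

lemma reach_cong:
  assumes "\<And>x. x \<in> A \<Longrightarrow> g x = h x"
  shows "reach g A t = reach h A t"
proof -
  have "x \<in> reach g A t \<Longrightarrow> x \<in> reach h A t" if "\<And>x. x \<in> A \<Longrightarrow> g x = h x" for x g h
    by (induction rule: reach.induct) (use that in \<open>auto intro: reach.intros\<close>)
  from this[of g h] this[of h g] assms show ?thesis by auto
qed

text \<open>
  Classify by the last vertex \<open>x\<close> before \<open>t\<close>. Such a chain never has to pass through \<open>x\<close> earlier,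
  so \<open>x\<close> may be dropped from the set of admissible vertices.
\<close>

lemma reach_decompose:
  "reach h A t = insert t (\<Union>x\<in>{x \<in> A. h x = t}. reach h (A - {x}) x)" (is "?l = ?r")
proof (intro equalityI subsetI)
  fix v assume "v \<in> ?l"
  then show "v \<in> ?r"
  proof induction
    case (step v)
    show ?case
    proof (cases "h v = t")
      case True
      then show ?thesis using step.hyps by (auto intro: reach.root)
    next
      case False
      with step.IH obtain x where x: "x \<in> A" "h x = t" "h v \<in> reach h (A - {x}) x" by auto
      then have "v \<in> reach h (A - {x}) x"
        using step.hyps by (cases "v = x") (auto intro: reach.intros)
      then show ?thesis using x by auto
    qed
  qed auto
next
  fix v assume "v \<in> ?r"
  then consider "v = t" | x where "x \<in> A" "h x = t" "v \<in> reach h (A - {x}) x" by auto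
  then show "v \<in> ?l"
  proof cases
    case (2 x)
    from 2(3) show ?thesis
      by induction (use 2 in \<open>auto intro: reach.intros\<close>)
  qed (auto intro: reach.root)
qed

text \<open>
  A chain of parents is determined by its start. After a vertex \<open>x\<close> with \<open>h x = t\<close> it continues with \<open>t\<close>,
  which is not admissible, so a chain passes through only one such vertex.
\<close>

lemma reach_disjoint:
  assumes "t \<notin> A" "x \<in> A" "x' \<in> A" "h x = t" "h x' = t" "x \<noteq> x'"
  shows "reach h (A - {x}) x \<inter> reach h (A - {x'}) x' = {}"
proof -
  have t: "t \<notin> reach h (A - {y}) y" if "y \<in> A" for y
    using reach_subset[of h "A - {y}" y] assms(1) that by auto
  have "v \<in> reach h (A - {x}) x \<Longrightarrow> v \<notin> reach h (A - {x'}) x'" for v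
  proof (induction rule: reach.induct)
    case root
    then show ?case using reach_step_down(2)[of x h "A - {x'}" x'] t assms by auto
  next
    case (step v)
    then show ?case using reach_step_down(2)[of v h "A - {x'}" x'] t assms by (cases "v = x'") auto
  qed
  then show ?thesis by auto
qed

lemma card_reach_decompose:
  assumes "finite A" "t \<notin> A"
  shows "card (reach h A t) = Suc (\<Sum>x\<in>{x \<in> A. h x = t}. card (reach h (A - {x}) x))"
proof -
  have "t \<notin> (\<Union>x\<in>{x \<in> A. h x = t}. reach h (A - {x}) x)"
    using reach_subset[of h] assms(2) by fastforce
  moreover have "card (\<Union>x\<in>{x \<in> A. h x = t}. reach h (A - {x}) x) = (\<Sum>x\<in>{x \<in> A. h x = t}. card (reach h (A - {x}) x))"
    using assms by (intro card_UN_disjoint) (auto simp: finite_reach reach_disjoint)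
  ultimately show ?thesis
    using assms by (subst reach_decompose) (simp add: finite_reach)
qed

text \<open>
  Cutting the edge from \<open>x\<close> to the root \<open>t\<close> makes \<open>x\<close> a further root. This is what exposing one
  more vertex of a path does: the number of prescribed roots grows by one.
\<close>

lemma bij_betw_forests_attach:
  assumes "t \<in> S" "S \<subseteq> V" "x \<in> V - S"
  shows "bij_betw (\<lambda>h. h(x := t)) (forests V (insert x S)) {h \<in> forests V S. h x = t}"
proof (rule bij_betw_byWitness[where f' = "\<lambda>h. h(x := undefined)"])
  let ?F = "forests V (insert x S)" and ?G = "{h \<in> forests V S. h x = t}"
  show "\<forall>h\<in>?F. (h(x := t))(x := undefined) = h"
    by (auto simp: forests_def fun_eq_iff PiE_def extensional_def)
  show "\<forall>h\<in>?G. (h(x := undefined))(x := t) = h" by auto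
  show "(\<lambda>h. h(x := t)) ` ?F \<subseteq> ?G"
  proof safe
    fix h assume h: "h \<in> ?F"
    then obtain \<delta> :: "'a \<Rightarrow> nat" where ext: "h \<in> (V - insert x S) \<rightarrow>\<^sub>E V"
      and \<delta>: "\<And>y. y \<in> V - insert x S \<Longrightarrow> \<delta> (h y) < \<delta> y"
      unfolding forests_def by auto
    have "\<exists>\<delta>' :: 'a \<Rightarrow> nat. \<forall>y\<in>V - S. \<delta>' ((h(x := t)) y) < \<delta>' y"
      by (rule rank_with_bottom[where R = S and \<delta> = \<delta>]) (use assms \<delta> in auto)
    moreover have "h(x := t) \<in> (V - S) \<rightarrow>\<^sub>E V"
      using ext assms by (auto simp: PiE_def extensional_def Pi_def)
    ultimately show "h(x := t) \<in> forests V S" by (auto simp: forests_def)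
  qed auto
  show "(\<lambda>h. h(x := undefined)) ` ?G \<subseteq> ?F"
  proof safe
    fix h assume h: "h \<in> forests V S" and t: "t = h x"
    then obtain \<delta> :: "'a \<Rightarrow> nat" where ext: "h \<in> (V - S) \<rightarrow>\<^sub>E V"
      and \<delta>: "\<And>y. y \<in> V - S \<Longrightarrow> \<delta> (h y) < \<delta> y"
      unfolding forests_def by auto
    show "h(x := undefined) \<in> ?F" unfolding forests_def
      using ext \<delta> by (auto simp: PiE_def extensional_def Pi_def intro!: exI[of _ \<delta>])
  qed
qed

text \<open>
  Here \<open>S\<close> is the set of vertices of a path exposed so far and \<open>t\<close> its current end. Given the
  forest that hangs off these vertices, the vertices counted are the possible far ends of a
  continuation of the path inside \<open>K\<close>.
\<close>

definition path_count :: "'a set \<Rightarrow> 'a set \<Rightarrow> 'a set \<Rightarrow> 'a \<Rightarrow> nat" where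
  "path_count V K S t = (\<Sum>h\<in>forests V S. card (reach h (K - S) t))"

text \<open>
  Either the path ends at \<open>t\<close>, or its next vertex \<open>x \<in> K - S\<close> is exposed.
\<close>

lemma path_count_rec:
  assumes "finite V" "K \<subseteq> V" "S \<subseteq> K" "t \<in> S"
  shows "path_count V K S t = card (forests V S) + (\<Sum>x\<in>K - S. path_count V K (insert x S) x)"
proof -
  have finK: "finite K" and finF: "finite (forests V S)"
    using assms finite_subset finite_forests by auto
  have "path_count V K S t =
      (\<Sum>h\<in>forests V S. Suc (\<Sum>x\<in>{x \<in> K - S. h x = t}. card (reach h (K - S - {x}) x)))"
    unfolding path_count_def using assms finK by (intro sum.cong refl card_reach_decompose) auto
  also have "\<dots> = card (forests V S) +
      (\<Sum>h\<in>forests V S. \<Sum>x\<in>{x \<in> K - S. h x = t}. card (reach h (K - S - {x}) x))"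
    using finF by (simp add: sum_Suc)
  also have "(\<Sum>h\<in>forests V S. \<Sum>x\<in>{x \<in> K - S. h x = t}. card (reach h (K - S - {x}) x)) =
      (\<Sum>x\<in>K - S. \<Sum>h\<in>{h \<in> forests V S. h x = t}. card (reach h (K - S - {x}) x))"
    by (rule sum.swap_restrict) (use finF finK in auto)
  also have "\<dots> = (\<Sum>x\<in>K - S. path_count V K (insert x S) x)"
  proof (intro sum.cong refl)
    fix x assume x: "x \<in> K - S"
    have "K - S - {x} = K - insert x S" by auto
    have "(\<Sum>h\<in>{h \<in> forests V S. h x = t}. card (reach h (K - S - {x}) x)) =
        (\<Sum>h\<in>forests V (insert x S). card (reach (h(x := t)) (K - S - {x}) x))"
      by (rule sum.reindex_bij_betw[symmetric, OF bij_betw_forests_attach]) (use assms x in auto)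
    also have "\<dots> = (\<Sum>h\<in>forests V (insert x S). card (reach h (K - S - {x}) x))"
      by (intro sum.cong refl arg_cong[of _ _ card] reach_cong) auto
    finally show "(\<Sum>h\<in>{h \<in> forests V S. h x = t}. card (reach h (K - S - {x}) x)) = path_count V K (insert x S) x"
      unfolding path_count_def by (simp only: \<open>K - S - {x} = K - insert x S\<close>)
  qed
  finally show ?thesis .
qed

text \<open>
  The recursion of \<open>path_count\<close> after division by \<open>n\<^bsup>n-s-1\<^esup>\<close>, where \<open>s\<close> is the number of exposed
  vertices and \<open>j = k - s\<close> the number of vertices of \<open>K\<close> that are still available. Writing \<open>W s\<close>
  for its value, it reads \<open>W s = s + (k - s) / n * W (s + 1)\<close>. At \<open>s = 1\<close>, where the normalising
  factor is the number of trees, it is the mean size of the component of a given low vertex.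
\<close>

primrec path_mean :: "real \<Rightarrow> nat \<Rightarrow> nat \<Rightarrow> real" where
  "path_mean n k 0 = k"
| "path_mean n k (Suc j) = (real k - real (Suc j)) + real (Suc j) / n * path_mean n k j"

lemma path_count_eq:
  assumes "finite V" "K \<subseteq> V" "S \<subseteq> K" "t \<in> S"
  shows "real (path_count V K S t) * real (card V) ^ Suc (card S) =
    real (card V) ^ card V * path_mean (card V) (card K) (card (K - S))"
  using assms(3,4)
proof (induction "card (K - S)" arbitrary: S t)
  case (0 S t)
  have "finite K" using assms finite_subset by auto
  with 0 have S: "S = K" by auto
  then have "path_count V K S t = card (forests V S)"
    using path_count_rec[OF assms(1,2) 0(2,3)] by simp
  with card_forests_power[OF assms(1), of S] 0 assms(2) S show ?case
    by (simp add: mult.commute)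
next
  case (Suc j S t)
  have finK: "finite K" using assms(1,2) finite_subset by auto
  have finS: "finite S" using finK Suc.prems(1) finite_subset by auto
  have n: "card V > 0" using assms(1,2) Suc.prems by (auto simp: card_gt_0_iff)
  have kj: "card K = card S + Suc j"
    using Suc.hyps(2) card_Diff_subset[OF finS Suc.prems(1)] card_mono[OF finK Suc.prems(1)] by simp
  let ?n = "real (card V)"
  have P: "real (path_count V K (insert x S) x) * ?n ^ Suc (card S) = ?n ^ card V * path_mean ?n (card K) j / ?n"
    if x: "x \<in> K - S" for x
  proof -
    have s: "card (insert x S) = Suc (card S)" using x finS by simp
    have "K - insert x S = K - S - {x}" by auto
    then have j: "j = card (K - insert x S)" using Suc.hyps(2) x finK by simp
    have "real (path_count V K (insert x S) x) * ?n ^ Suc (card (insert x S)) =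
        ?n ^ card V * path_mean ?n (card K) (card (K - insert x S))"
      by (rule Suc.hyps(1)[OF j]) (use x Suc.prems in auto)
    then have "real (path_count V K (insert x S) x) * ?n ^ Suc (card S) * ?n = ?n ^ card V * path_mean ?n (card K) j"
      unfolding s j[symmetric] power_Suc2[of ?n "Suc (card S)"]
      by (simp only: mult.assoc)
    then show ?thesis using n by (simp add: eq_divide_eq)
  qed
  have "real (path_count V K S t) * ?n ^ Suc (card S) =
     real (card (forests V S)) * ?n ^ Suc (card S) +
     (\<Sum>x\<in>K - S. real (path_count V K (insert x S) x) * ?n ^ Suc (card S))"
    unfolding path_count_rec[OF assms(1,2) Suc.prems]
    by (simp only: of_nat_add of_nat_sum distrib_right sum_distrib_right)
  also have "\<dots> = ?n ^ card V * real (card S) + (\<Sum>x\<in>K - S. ?n ^ card V * path_mean ?n (card K) j / ?n)"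
    using card_forests_power[OF assms(1), of S] assms(2) Suc.prems
    by (intro arg_cong2[of _ _ _ _ "(+)"] sum.cong refl P) (auto simp: mult.commute)
  also have "\<dots> = ?n ^ card V * path_mean ?n (card K) (Suc j)"
    using n kj Suc.hyps(2)[symmetric] by (simp add: field_simps)
  finally show ?case using Suc.hyps(2) by simp
qed

section \<open>Trees as parent functions\<close>

definition forest_edges :: "'a set \<Rightarrow> 'a \<Rightarrow> ('a \<Rightarrow> 'a) \<Rightarrow> 'a set set" where
  "forest_edges V r g = (\<lambda>x. {x, g x}) ` (V - {r})"

lemma forest_edges_iff:
  "{u, v} \<in> forest_edges V r g \<longleftrightarrow> (u \<in> V - {r} \<and> v = g u) \<or> (v \<in> V - {r} \<and> u = g v)"
  unfolding forest_edges_def by (auto simp: doubleton_eq_iff)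

lemma adj_rtrancl_sym: "(u, v) \<in> (adj E)\<^sup>* \<Longrightarrow> (v, u) \<in> (adj E)\<^sup>*"
proof -
  have "sym (adj E)" by (auto simp: sym_def adj_def insert_commute)
  then show "(u, v) \<in> (adj E)\<^sup>* \<Longrightarrow> (v, u) \<in> (adj E)\<^sup>*"
    using sym_rtrancl symD by metis
qed

lemma cycle_neighbours:
  assumes "is_cycle E xs" "x \<in> set xs"
  obtains a b where "a \<in> set xs" "b \<in> set xs" "a \<noteq> b" "{a, x} \<in> E" "{x, b} \<in> E"
proof -
  obtain ys zs where xs: "xs = ys @ x # zs" using split_list[OF assms(2)] by blast
  have len: "length ys + length zs \<ge> 2" and dist: "distinct xs"
    and succ: "successively (\<lambda>u v. {u, v} \<in> E) xs" and closing: "{last xs, hd xs} \<in> E"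
    using assms unfolding is_cycle_def xs by auto
  consider "ys = []" "zs \<noteq> []" | "ys \<noteq> []" "zs = []" | "ys \<noteq> []" "zs \<noteq> []"
    using len by fastforce
  then show ?thesis
  proof cases
    case 1
    then obtain b zs' where zs: "zs = b # zs'" "zs' \<noteq> []" using len by (cases zs) (auto simp: Suc_le_eq)
    show ?thesis
      by (rule that[of "last zs'" b])
        (use zs 1 dist succ closing xs last_in_set[of zs'] in auto)
  next
    case 2
    then obtain a ys' where ys: "ys = a # ys'" "ys' \<noteq> []" using len by (cases ys) (auto simp: Suc_le_eq)
    have "{last ys, x} \<in> E" using succ 2 unfolding xs by (simp add: successively_append_iff)
    moreover have "{x, a} \<in> E" using closing 2 ys unfolding xs by simp
    moreover have "last ys' \<in> set ys'" using ys by simp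
    moreover from this have "last ys' \<noteq> a" using dist ys unfolding xs by auto
    ultimately show ?thesis
      using that[of "last ys'" a] ys 2 unfolding xs by auto
  next
    case 3
    have "{last ys, x} \<in> E" "{x, hd zs} \<in> E"
      using succ 3 unfolding xs by (auto simp: successively_append_iff successively_Cons)
    moreover have "last ys \<in> set ys" "hd zs \<in> set zs" using 3 by simp_all
    moreover from this have "last ys \<noteq> hd zs" using dist unfolding xs by auto
    ultimately show ?thesis using that[of "last ys" "hd zs"] unfolding xs by auto
  qed
qed

text \<open>
  There is no cycle, since a vertex of maximal rank on one would have two distinct neighbours
  of smaller rank, while only its parent can be such a neighbour.
\<close>

lemma is_tree_forest_edges:
  assumes "finite V" "r \<in> V" "g \<in> forests V {r}"
  shows "is_tree V (forest_edges V r g)"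
proof -
  obtain \<delta> :: "'a \<Rightarrow> nat" where g: "\<And>x. x \<in> V - {r} \<Longrightarrow> g x \<in> V"
    and \<delta>: "\<And>x. x \<in> V - {r} \<Longrightarrow> \<delta> (g x) < \<delta> x"
    using assms(3) unfolding forests_def by blast
  let ?E = "forest_edges V r g"
  have "simple_graph V ?E"
    unfolding simple_graph_def
  proof (intro conjI ballI)
    fix e assume "e \<in> ?E"
    then obtain x where x: "x \<in> V - {r}" "e = {x, g x}" unfolding forest_edges_def by blast
    then show "e \<subseteq> V" using g by auto
    have "x \<noteq> g x" using \<delta>[OF x(1)] by auto
    then show "card e = 2" using x by simp
  qed (rule assms(1))
  moreover have conn: "(x, r) \<in> (adj ?E)\<^sup>*" if "x \<in> V" for x
    using that
  proof (induction "\<delta> x" arbitrary: x rule: less_induct)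
    case (less x)
    show ?case
    proof (cases "x = r")
      case False
      then have "(x, g x) \<in> adj ?E" using less.prems by (auto simp: adj_def forest_edges_def)
      moreover have "(g x, r) \<in> (adj ?E)\<^sup>*" using less False g \<delta> by auto
      ultimately show ?thesis by (rule converse_rtrancl_into_rtrancl)
    qed simp
  qed
  then have "connected_graph V ?E"
    unfolding connected_graph_def using assms(2) by (metis adj_rtrancl_sym empty_iff rtrancl_trans)
  moreover have "\<not> is_cycle ?E xs" for xs
  proof
    assume cyc: "is_cycle ?E xs"
    then have "set xs \<noteq> {}" by (auto simp: is_cycle_def)
    then have "Max (\<delta> ` set xs) \<in> \<delta> ` set xs" by (intro Max_in) auto
    then obtain x where x: "x \<in> set xs" and Max: "\<delta> x = Max (\<delta> ` set xs)" by auto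
    have max: "\<And>y. y \<in> set xs \<Longrightarrow> \<delta> y \<le> \<delta> x" unfolding Max by (intro Max_ge) auto
    obtain a b where ab: "a \<in> set xs" "b \<in> set xs" "a \<noteq> b" "{a, x} \<in> ?E" "{x, b} \<in> ?E"
      using cycle_neighbours[OF cyc x] .
    have "a = g x" using ab(4) \<delta>[of a] max[OF ab(1)] unfolding forest_edges_iff by auto
    moreover have "b = g x" using ab(5) \<delta>[of b] max[OF ab(2)] unfolding forest_edges_iff by auto
    ultimately show False using ab by simp
  qed
  ultimately show ?thesis unfolding is_tree_def by blast
qed

text \<open>
  Induction on the rank of \<open>x\<close>: if the edge from \<open>x\<close> to \<open>g x\<close> were not a parent step of \<open>x\<close> in \<open>h\<close>, it would be
  the parent step of \<open>g x\<close> in \<open>h\<close>, hence by induction also in \<open>g\<close>, and the rank would increase again.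
\<close>

lemma inj_on_forest_edges: "inj_on (forest_edges V r) (forests V {r})"
proof (rule inj_onI)
  fix g h assume g: "g \<in> forests V {r}" and h: "h \<in> forests V {r}"
    and eq: "forest_edges V r g = forest_edges V r h"
  obtain \<delta> :: "'a \<Rightarrow> nat" where ext: "g \<in> (V - {r}) \<rightarrow>\<^sub>E V" and \<delta>: "\<And>x. x \<in> V - {r} \<Longrightarrow> \<delta> (g x) < \<delta> x"
    using g unfolding forests_def by blast
  have "g x = h x" if "x \<in> V - {r}" for x
    using that
  proof (induction "\<delta> x" arbitrary: x rule: less_induct)
    case (less x)
    have "{x, g x} \<in> forest_edges V r h" using less.prems eq by (auto simp: forest_edges_def)
    then consider "g x = h x" | "g x \<in> V - {r}" "x = h (g x)" unfolding forest_edges_iff by blast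
    then show ?case
    proof cases
      case 2
      then have "g (g x) = x" using less \<delta> by metis
      then show ?thesis using \<delta>[of x] \<delta>[of "g x"] 2 less.prems by simp
    qed
  qed
  then show "g = h"
    using ext h by (intro PiE_ext[of g "V - {r}" "\<lambda>_. V" h]) (auto simp: forests_def)
qed

lemma rtrancl_adj_distinct_path:
  assumes "(a, b) \<in> (adj E)\<^sup>*"
  obtains xs where "xs \<noteq> []" "distinct xs" "hd xs = a" "last xs = b" "successively (\<lambda>u v. {u, v} \<in> E) xs"
  using assms
proof (induction arbitrary: thesis rule: converse_rtrancl_induct)
  case base
  show ?case by (rule base[of "[b]"]) auto
next
  case (step a c)
  obtain xs where xs: "xs \<noteq> []" "distinct xs" "hd xs = c" "last xs = b" "successively (\<lambda>u v. {u, v} \<in> E) xs"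
    using step.IH by blast
  show ?case
  proof (cases "a \<in> set xs")
    case True
    then obtain ys zs where "xs = ys @ a # zs" by (meson split_list)
    then show ?thesis using xs by (intro step.prems[of "a # zs"]) (auto simp: successively_append_iff)
  next
    case False
    then show ?thesis using xs step.hyps
      by (intro step.prems[of "a # xs"]) (auto simp: successively_Cons adj_def)
  qed
qed

text \<open>
  The parent of a vertex is a neighbour that is closer to \<open>r\<close>. The edges so obtained already
  connect all vertices, so any further edge of \<open>T\<close> would close a cycle.
\<close>

lemma ex_forest_edges_of_tree:
  assumes "r \<in> V" "is_tree V T"
  shows "\<exists>g\<in>forests V {r}. forest_edges V r g = T"
proof -
  have edge: "\<And>e. e \<in> T \<Longrightarrow> e \<subseteq> V \<and> card e = 2"
    and conn: "\<And>u. u \<in> V \<Longrightarrow> (u, r) \<in> (adj T)\<^sup>*" and acyc: "\<And>xs. \<not> is_cycle T xs"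
    and fin: "finite V"
    using assms unfolding is_tree_def simple_graph_def connected_graph_def by blast+
  define \<delta> where "\<delta> x = (LEAST n. (x, r) \<in> adj T ^^ n)" for x
  have "\<exists>y. {x, y} \<in> T \<and> \<delta> y < \<delta> x" if x: "x \<in> V - {r}" for x
  proof -
    obtain n where "(x, r) \<in> adj T ^^ n" using conn[of x] x rtrancl_imp_relpow by blast
    then have dx: "(x, r) \<in> adj T ^^ \<delta> x" unfolding \<delta>_def by (rule LeastI)
    then obtain m where m: "\<delta> x = Suc m" using x by (cases "\<delta> x") auto
    then obtain y where y: "(x, y) \<in> adj T" "(y, r) \<in> adj T ^^ m"
      using dx relpow_Suc_D2 by metis
    from y(2) have "\<delta> y \<le> m" unfolding \<delta>_def by (rule Least_le)
    then show ?thesis using y m by (auto simp: adj_def)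
  qed
  then obtain p where p: "\<And>x. x \<in> V - {r} \<Longrightarrow> {x, p x} \<in> T \<and> \<delta> (p x) < \<delta> x" by metis
  define g where "g = restrict p (V - {r})"
  have "p x \<in> V" if "x \<in> V - {r}" for x using p[OF that] edge[of "{x, p x}"] by simp
  then have "g \<in> (V - {r}) \<rightarrow>\<^sub>E V" unfolding g_def by auto
  then have g: "g \<in> forests V {r}" unfolding forests_def using p by (auto simp: g_def intro!: exI[of _ \<delta>])
  have sub: "forest_edges V r g \<subseteq> T" using p by (auto simp: forest_edges_def g_def)
  moreover have "T \<subseteq> forest_edges V r g"
  proof
    fix e assume e: "e \<in> T"
    then obtain a b where ab: "e = {a, b}" "a \<noteq> b" using edge card_2_iff by metis
    have "connected_graph V (forest_edges V r g)"
      using is_tree_forest_edges[OF fin assms(1) g] by (simp add: is_tree_def)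
    then have "(a, b) \<in> (adj (forest_edges V r g))\<^sup>*"
      using edge[OF e] ab unfolding connected_graph_def by auto
    then obtain xs where xs: "xs \<noteq> []" "distinct xs" "hd xs = a" "last xs = b"
      and succ: "successively (\<lambda>u v. {u, v} \<in> forest_edges V r g) xs"
      by (rule rtrancl_adj_distinct_path)
    show "e \<in> forest_edges V r g"
    proof (rule ccontr)
      assume e': "e \<notin> forest_edges V r g"
      obtain x xs' where 1: "xs = x # xs'" using xs by (cases xs) auto
      then obtain y xs'' where 2: "xs' = y # xs''" using xs ab by (cases xs') auto
      then obtain z zs where 3: "xs'' = z # zs" using xs ab 1 e' succ by (cases xs'') auto
      have "successively (\<lambda>u v. {u, v} \<in> T) xs"
        using succ by (rule successively_mono) (use sub in auto)
      then have "is_cycle T xs"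
        using xs ab e unfolding is_cycle_def by (auto simp: 1 2 3 insert_commute)
      with acyc show False by blast
    qed
  qed
  ultimately show ?thesis using g by blast
qed

lemma bij_betw_forests_trees:
  assumes "finite V" "r \<in> V"
  shows "bij_betw (forest_edges V r) (forests V {r}) {T. is_tree V T}"
  unfolding bij_betw_def
proof (intro conjI equalityI subsetI)
  fix T assume "T \<in> {T. is_tree V T}"
  then show "T \<in> forest_edges V r ` forests V {r}" using ex_forest_edges_of_tree[OF assms(2)] by blast
qed (use is_tree_forest_edges[OF assms] in \<open>auto simp: inj_on_forest_edges\<close>)

text \<open>
  Every edge joins a vertex to its parent, so a walk from the root that stays in \<open>K\<close> can only
  visit vertices all of whose ancestors lie in \<open>K\<close>.
\<close>

lemma low_component_eq_reach:
  assumes "r \<in> K" "K \<subseteq> V"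
  shows "{v \<in> K. (r, v) \<in> (adj (induced_edges (forest_edges V r g) K))\<^sup>*} = reach g (K - {r}) r"
proof (intro equalityI subsetI)
  let ?E = "induced_edges (forest_edges V r g) K"
  fix v assume "v \<in> {v \<in> K. (r, v) \<in> (adj ?E)\<^sup>*}"
  then have "(r, v) \<in> (adj ?E)\<^sup>*" by simp
  then show "v \<in> reach g (K - {r}) r"
  proof induction
    case base
    show ?case by (rule reach.root)
  next
    case (step v w)
    from step.hyps have e: "{v, w} \<in> forest_edges V r g" "v \<in> K" "w \<in> K"
      by (auto simp: adj_def induced_edges_def)
    then show ?case unfolding forest_edges_iff using step.IH
      by (metis DiffD1 DiffD2 DiffI reach.step reach_step_down(2) singletonI singletonD)
  qed
next
  let ?E = "induced_edges (forest_edges V r g) K"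
  fix v assume "v \<in> reach g (K - {r}) r"
  then have "v \<in> K \<and> (r, v) \<in> (adj ?E)\<^sup>*"
  proof induction
    case root
    then show ?case using assms by simp
  next
    case (step v)
    then have "(g v, v) \<in> adj ?E"
      using assms by (auto simp: adj_def induced_edges_def forest_edges_iff)
    then show ?case using step by auto
  qed
  then show "v \<in> {v \<in> K. (r, v) \<in> (adj ?E)\<^sup>*}" by simp
qed

section \<open>Bounds for the path recursion\<close>

text \<open>
  With \<open>s = k - j\<close>, the right-hand side is the affine function of \<open>s\<close> that solves the recursion
  \<open>W s = s + k / n * W (s + 1)\<close>, whose weight \<open>k / n\<close> dominates the true weight \<open>(k - s) / n\<close>.
\<close>

lemma path_mean_upper:
  fixes j k d :: nat
  assumes "0 < d" "j \<le> k" and n: "n = real k + real d"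
  shows "path_mean n k j \<le> (real k - real j) * n / real d + real k * n / (real d)\<^sup>2"
  using assms(2)
proof (induction j)
  case 0
  have "real k * 1 \<le> real k * (n / d)" using assms by (intro mult_left_mono) (auto simp: field_simps)
  moreover have "0 \<le> real k * n / (real d)\<^sup>2" using n by simp
  ultimately show ?case by simp
next
  case (Suc j)
  define s where "s = real k - real (Suc j)"
  have n0: "n > 0" using assms by simp
  have d0: "real d > 0" using assms by simp
  have s: "s \<ge> 0" and js: "real (Suc j) = real k - s" "real k - real j = s + 1"
    using Suc.prems by (auto simp: s_def)
  have IH: "path_mean n k j \<le> (s + 1) * n / d + k * n / (real d)\<^sup>2"
    using Suc js by simp
  have "path_mean n k (Suc j) = s + (k - s) / n * path_mean n k j"
    using js s_def by simp
  also have "\<dots> \<le> s + (k - s) / n * ((s + 1) * n / d + k * n / (real d)\<^sup>2)"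
    using js n0 by (intro add_left_mono mult_left_mono IH) (metis divide_nonneg_pos of_nat_0_le_iff)
  also have "\<dots> = s + (k - s) * ((s + 1) / d + k / (real d)\<^sup>2)"
    using n0 by (simp add: field_simps)
  also have "\<dots> \<le> s + k * ((s + 1) / d + k / (real d)\<^sup>2)"
    using s by (intro add_left_mono mult_right_mono) auto
  also have "\<dots> = s * n / d + k * n / (real d)\<^sup>2"
    using d0 unfolding n by (simp add: field_simps power2_eq_square)
  finally show ?case by (simp add: s_def)
qed

lemma path_mean_le:
  assumes "j \<le> k" "real k \<le> n" "n > 0"
  shows "path_mean n k j \<le> n"
  using assms(1)
proof (induction j)
  case 0
  then show ?case using assms by simp
next
  case (Suc j)
  have "real (Suc j) / n * path_mean n k j \<le> real (Suc j) / n * n"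
    using Suc assms by (intro mult_left_mono) auto
  then show ?case using assms by simp
qed

text \<open>
  With \<open>s = k - j\<close>, the function \<open>n - d * n / s\<close> is a subsolution of the recursion. Its
  loss \<open>d * n / s\<close> is small only for large \<open>s\<close>.
\<close>

lemma path_mean_lower:
  fixes j k d :: nat
  assumes "j < k" "0 < n" and n: "n = real k + real d"
  shows "path_mean n k j \<ge> n - d * (n / (real k - real j))"
  using assms(1)
proof (induction j)
  case 0
  have "real d * 1 \<le> real d * (n / k)" using assms by (intro mult_left_mono) (auto simp: field_simps)
  then show ?case using n by simp
next
  case (Suc j)
  define s where "s = real k - real (Suc j)"
  have s: "s > 0" and js: "real (Suc j) = real k - s" "real k - real j = s + 1"
    using Suc.prems by (auto simp: s_def)
  have "s \<le> n" using n js by simp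
  have IH: "path_mean n k j \<ge> n - d * (n / (s + 1))"
    using Suc js by simp
  have *: "(k + 1) / (s + 1) \<le> n / s" if "d > 0"
  proof -
    have "real k + 1 \<le> n" using n that by simp
    then have "s * (k + 1) \<le> s * n" using s by simp
    then show ?thesis using s \<open>s \<le> n\<close> by (simp add: field_simps)
  qed
  have "n - d * (n / s) \<le> n - d * ((k + 1) / (s + 1))"
  proof (cases "d = 0")
    case False
    then show ?thesis using mult_left_mono[OF *, of "real d"] by simp
  qed simp
  also have "(k + 1) / (s + 1) = 1 + (k - s) / (s + 1)"
    using s by (simp add: field_simps)
  also have "n - d * (1 + (k - s) / (s + 1)) = s + (k - s) * (1 - d / (s + 1))"
    unfolding n by (simp add: algebra_simps)
  also have "(k - s) * (1 - d / (s + 1)) = (k - s) / n * (n * (1 - d / (s + 1)))"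
    using \<open>0 < n\<close> by simp
  also have "n * (1 - d / (s + 1)) = n - d * (n / (s + 1))"
    by (simp add: algebra_simps)
  also have "s + (k - s) / n * (n - d * (n / (s + 1))) \<le> s + (k - s) / n * path_mean n k j"
    using js \<open>0 < n\<close> by (intro add_left_mono mult_left_mono IH) (metis divide_nonneg_pos of_nat_0_le_iff)
  also have "\<dots> = path_mean n k (Suc j)" using js s_def by simp
  finally show ?case by (simp add: s_def)
qed

text \<open>
  Complements the previous bound for small \<open>s\<close>: since \<open>W (s + 1) \<le> n\<close>, the recursion gives
  \<open>W s \<ge> W (s + 1) - d\<close>.
\<close>

lemma path_mean_decrease:
  fixes i j k d :: nat
  assumes "i \<le> j" "j \<le> k" "0 < n" and n: "n = real k + real d"
  shows "path_mean n k i - d * (real j - real i) \<le> path_mean n k j"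
  using assms(1,2)
proof (induction j rule: dec_induct)
  case (step j)
  have le: "path_mean n k j \<le> n" by (rule path_mean_le) (use step assms in auto)
  have "(1 - real (Suc j) / n) * path_mean n k j \<le> (1 - real (Suc j) / n) * n"
    using le step.prems assms by (intro mult_left_mono) auto
  also have "\<dots> = n - real (Suc j)"
    using assms by (simp add: left_diff_distrib)
  finally have "path_mean n k j - real (Suc j) / n * path_mean n k j \<le> n - real (Suc j)"
    by (simp only: left_diff_distrib mult_1)
  then have "path_mean n k j - d \<le> path_mean n k (Suc j)"
    unfolding path_mean.simps using n by linarith
  then show ?case using step by (simp add: algebra_simps)
qed simp

text \<open>
  Descend from \<open>s = m\<close> to \<open>s = 1\<close>. The bound is best for \<open>m\<close> near \<open>sqrt n\<close>, where the loss is of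
  order \<open>d * sqrt n\<close>; this is where the threshold of the phase transition comes from.
\<close>

lemma path_mean_last_lower:
  fixes m k d :: nat
  assumes "0 < m" "m \<le> k" and n: "n = real k + real d"
  shows "n - d * (n / m + m) \<le> path_mean n k (k - 1)"
proof -
  have n0: "n > 0" using assms by simp
  have "n - d * (n / m + m) \<le> (n - d * (n / m)) - d * (real (k - 1) - real (k - m))"
    using assms by (simp add: algebra_simps of_nat_diff)
  also have "n - d * (n / m) \<le> path_mean n k (k - m)"
    using path_mean_lower[of "k - m" k n d] assms n0 by (simp add: of_nat_diff)
  also have "path_mean n k (k - m) - d * (real (k - 1) - real (k - m)) \<le> path_mean n k (k - 1)"
    by (rule path_mean_decrease) (use assms n0 in auto)
  finally show ?thesis by simp
qed

lemma path_mean_last_upper: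
  fixes k d :: nat
  assumes "0 < d" "0 < k" and n: "n = real k + real d"
  shows "path_mean n k (k - 1) \<le> (n / d)\<^sup>2"
proof -
  have "path_mean n k (k - 1) \<le> (real k - real (k - 1)) * n / real d + real k * n / (real d)\<^sup>2"
    by (rule path_mean_upper) (use assms in auto)
  also have "\<dots> = (n / d)\<^sup>2"
    using assms by (simp add: of_nat_diff field_simps power2_eq_square)
  finally show ?thesis .
qed

section \<open>Low components and connected pairs\<close>

definition low_conn :: "nat \<Rightarrow> nat set set \<Rightarrow> (nat \<times> nat) set" where
  "low_conn k T = {(u, v) \<in> {1..k} \<times> {1..k}. (u, v) \<in> (adj (induced_edges T {1..k}))\<^sup>*}"

lemma low_components_eq: "low_components k T = {1..k} // low_conn k T"
  by (simp add: low_components_def components_of_graph_def low_conn_def)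

lemma equiv_low_conn: "equiv {1..k} (low_conn k T)"
proof (rule equivI)
  show "low_conn k T \<subseteq> {1..k} \<times> {1..k}" "refl_on {1..k} (low_conn k T)"
    by (auto simp: low_conn_def refl_on_def)
  show "sym (low_conn k T)"
    by (auto simp: low_conn_def sym_def adj_rtrancl_sym)
  show "trans (low_conn k T)"
    by (auto simp: low_conn_def trans_def intro: rtrancl_trans)
qed

lemma finite_low_components: "finite (low_components k T)"
  unfolding low_components_eq by (intro finite_quotient) (auto simp: low_conn_def)

lemma low_component_subset: "C \<in> low_components k T \<Longrightarrow> C \<subseteq> {1..k}"
  unfolding low_components_eq by (rule in_quotient_imp_subset[OF equiv_low_conn])

lemma card_low_component_le: "C \<in> low_components k T \<Longrightarrow> card C \<le> c_max k T"
  unfolding c_max_def by (intro Max_ge) (auto simp: finite_low_components)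

lemma c_max_attained: "c_max k T = 0 \<or> (\<exists>C\<in>low_components k T. card C = c_max k T)"
proof -
  have "c_max k T \<in> insert 0 (card ` low_components k T)"
    unfolding c_max_def by (intro Max_in) (auto simp: finite_low_components)
  then show ?thesis by auto
qed

lemma c_max_le: "c_max k T \<le> k"
  using c_max_attained[of k T]
proof
  assume "\<exists>C\<in>low_components k T. card C = c_max k T"
  then obtain C where C: "C \<in> low_components k T" "card C = c_max k T" by blast
  have "card C \<le> card {1..k}" by (intro card_mono low_component_subset[OF C(1)]) simp
  then show ?thesis using C(2) by simp
qed simp

lemma low_conn_Sigma:
  "low_conn k T = (SIGMA r:{1..k}. {v \<in> {1..k}. (r, v) \<in> (adj (induced_edges T {1..k}))\<^sup>*})"
  by (auto simp: low_conn_def)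

lemma card_low_conn_le: "card (low_conn k T) \<le> k * c_max k T"
proof -
  have "card (low_conn k T `` {r}) \<le> c_max k T" if "r \<in> {1..k}" for r
    using that by (intro card_low_component_le) (simp only: low_components_eq quotientI)
  then have "card {v \<in> {1..k}. (r, v) \<in> (adj (induced_edges T {1..k}))\<^sup>*} \<le> c_max k T" if "r \<in> {1..k}" for r
    using that by (auto simp: low_conn_def Image_def)
  then have "(\<Sum>r\<in>{1..k}. card {v \<in> {1..k}. (r, v) \<in> (adj (induced_edges T {1..k}))\<^sup>*}) \<le>
      (\<Sum>r\<in>{1..k}. c_max k T)"
    by (rule sum_mono)
  then have "card (low_conn k T) \<le> (\<Sum>r\<in>{1..k}. c_max k T)"
    unfolding low_conn_Sigma by (subst card_SigmaI) simp_all
  then show ?thesis by simp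
qed

lemma c_max_square_le: "(c_max k T)\<^sup>2 \<le> card (low_conn k T)"
  using c_max_attained[of k T]
proof
  assume "\<exists>C\<in>low_components k T. card C = c_max k T"
  then obtain C where C: "C \<in> low_components k T" "card C = c_max k T" by blast
  have "C \<times> C \<subseteq> low_conn k T"
    using in_quotient_imp_in_rel[OF equiv_low_conn] C(1) unfolding low_components_eq by blast
  moreover have "finite (low_conn k T)"
    by (rule finite_subset[of _ "{1..k} \<times> {1..k}"]) (auto simp: low_conn_def)
  ultimately have "card (C \<times> C) \<le> card (low_conn k T)" by (rule card_mono[rotated])
  then show ?thesis using C(2) by (simp add: card_cartesian_product power2_eq_square)
qed simp

lemma labeled_trees_forests:
  assumes "r \<in> {1..n}"
  shows "bij_betw (forest_edges {1..n} r) (forests {1..n} {r}) (labeled_trees n)"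
  unfolding labeled_trees_def by (rule bij_betw_forests_trees) (use assms in auto)

text \<open>
  For each low vertex \<open>r\<close>, rooting the trees at \<open>r\<close> turns the sizes of its component into a
  path count with the single exposed vertex \<open>r\<close>.
\<close>

lemma sum_card_low_conn:
  assumes "k \<le> n"
  shows "real (\<Sum>T\<in>labeled_trees n. card (low_conn k T)) =
    real (card (labeled_trees n)) * (real k * path_mean n k (k - 1))"
proof -
  let ?N = "real (card (labeled_trees n))"
  have pc: "real (path_count {1..n} {1..k} {r} r) = ?N * path_mean n k (k - 1)" if r: "r \<in> {1..k}" for r
  proof -
    have rn: "r \<in> {1..n}" and n: "real n > 0" using r assms by auto
    have "real (path_count {1..n} {1..k} {r} r) * real n ^ Suc 1 = real n ^ n * path_mean n k (k - 1)"
      using path_count_eq[of "{1..n}" "{1..k}" "{r}" r] r assms by simp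
    moreover have "?N * real n ^ Suc 1 = real n ^ n"
      using card_forests_power[of "{1..n}" "{r}"] bij_betw_same_card[OF labeled_trees_forests[OF rn]] rn by simp
    ultimately have "real (path_count {1..n} {1..k} {r} r) * real n ^ Suc 1 = (?N * path_mean n k (k - 1)) * real n ^ Suc 1"
      by (simp add: mult.commute mult.left_commute)
    then show ?thesis using n by simp
  qed
  let ?P = "\<lambda>T r. card {v \<in> {1..k}. (r, v) \<in> (adj (induced_edges T {1..k}))\<^sup>*}"
  have "(\<Sum>T\<in>labeled_trees n. card (low_conn k T)) = (\<Sum>T\<in>labeled_trees n. \<Sum>r\<in>{1..k}. ?P T r)"
    unfolding low_conn_Sigma by (subst card_SigmaI) auto
  also have "\<dots> = (\<Sum>r\<in>{1..k}. \<Sum>T\<in>labeled_trees n. ?P T r)" by (rule sum.swap)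
  also have "\<dots> = (\<Sum>r\<in>{1..k}. path_count {1..n} {1..k} {r} r)"
  proof (rule sum.cong)
    fix r assume r: "r \<in> {1..k}"
    then have rn: "r \<in> {1..n}" using assms by auto
    have "(\<Sum>T\<in>labeled_trees n. ?P T r) = (\<Sum>g\<in>forests {1..n} {r}. ?P (forest_edges {1..n} r g) r)"
      by (rule sum.reindex_bij_betw[symmetric, OF labeled_trees_forests[OF rn]])
    also have "\<dots> = path_count {1..n} {1..k} {r} r"
      unfolding path_count_def by (subst low_component_eq_reach) (use r assms in auto)
    finally show "(\<Sum>T\<in>labeled_trees n. ?P T r) = path_count {1..n} {1..k} {r} r" .
  qed simp
  finally have "real (\<Sum>T\<in>labeled_trees n. card (low_conn k T)) = (\<Sum>r\<in>{1..k}. ?N * path_mean n k (k - 1))"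
    using pc by simp
  then show ?thesis by simp
qed

section \<open>Moment bounds for the largest low component\<close>

lemma set_pmf_random_tree: "n \<ge> 1 \<Longrightarrow> set_pmf (random_tree n) = labeled_trees n"
  unfolding random_tree_def by (simp add: finite_labeled_trees labeled_trees_nonempty)

lemma integrable_random_tree: "n \<ge> 1 \<Longrightarrow> integrable (random_tree n) (f :: _ \<Rightarrow> real)"
  by (rule integrable_measure_pmf_finite) (simp add: set_pmf_random_tree finite_labeled_trees)

lemma expectation_card_low_conn:
  assumes "n \<ge> 1" "k \<le> n"
  shows "measure_pmf.expectation (random_tree n) (\<lambda>T. real (card (low_conn k T))) =
    real k * path_mean n k (k - 1)"
proof -
  have "card (labeled_trees n) > 0"
    using assms labeled_trees_nonempty finite_labeled_trees by (simp add: card_gt_0_iff)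
  then show ?thesis
    unfolding random_tree_def
    using sum_card_low_conn[OF assms(2)] assms
    by (simp add: integral_pmf_of_set labeled_trees_nonempty finite_labeled_trees)
qed

lemma random_tree_Markov:
  assumes "n \<ge> 1" "c > 0" "\<And>T. 0 \<le> u T" "\<And>T. T \<in> A \<Longrightarrow> c \<le> u T"
  shows "measure_pmf.prob (random_tree n) A \<le> measure_pmf.expectation (random_tree n) u / c"
proof -
  have "measure_pmf.prob (random_tree n) A \<le> measure_pmf.prob (random_tree n) {T \<in> space (random_tree n). c \<le> u T}"
    using assms(4) by (intro measure_pmf.finite_measure_mono) auto
  also have "\<dots> \<le> measure_pmf.expectation (random_tree n) u / c"
    by (rule integral_Markov_inequality_measure[where A = "{}"])
      (use assms integrable_random_tree in auto)
  finally show ?thesis .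
qed

text \<open>
  Markov's inequality for the number of connected low pairs, which is at least the square of
  the largest component and has mean at most \<open>n * (n / d)\<^sup>2\<close>.
\<close>

lemma prob_c_max_large:
  assumes "n \<ge> 1" "0 < d" "d \<le> n" "\<epsilon> > 0"
  shows "measure_pmf.prob (random_tree n) {T. \<epsilon> < real (c_max (n - d) T) / real n} \<le>
    (sqrt n / d)\<^sup>2 / \<epsilon>\<^sup>2"
proof -
  define k where "k = n - d"
  have nkd: "real n = real k + real d" and n: "real n > 0" using assms by (auto simp: k_def)
  have "measure_pmf.prob (random_tree n) {T. \<epsilon> < real (c_max k T) / real n} \<le>
      measure_pmf.expectation (random_tree n) (\<lambda>T. real (card (low_conn k T))) / (\<epsilon> * n)\<^sup>2"
  proof (rule random_tree_Markov)
    fix T assume "T \<in> {T. \<epsilon> < real (c_max k T) / real n}"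
    then have "\<epsilon> * n \<le> c_max k T" using n by (simp add: field_simps)
    then have "(\<epsilon> * n)\<^sup>2 \<le> (real (c_max k T))\<^sup>2" using assms by (intro power_mono) auto
    also have "\<dots> \<le> real (card (low_conn k T))"
      using c_max_square_le[of k T] by (metis of_nat_le_iff of_nat_power)
    finally show "(\<epsilon> * n)\<^sup>2 \<le> real (card (low_conn k T))" .
  qed (use assms in auto)
  also have "measure_pmf.expectation (random_tree n) (\<lambda>T. real (card (low_conn k T))) = k * path_mean n k (k - 1)"
    by (rule expectation_card_low_conn) (use assms in \<open>auto simp: k_def\<close>)
  also have "k * path_mean n k (k - 1) \<le> n * (n / d)\<^sup>2"
  proof (cases "k = 0")
    case False
    then have "k * path_mean n k (k - 1) \<le> k * (n / d)\<^sup>2"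
      using assms by (intro mult_left_mono path_mean_last_upper[OF _ _ nkd]) auto
    also have "\<dots> \<le> n * (n / d)\<^sup>2" by (intro mult_right_mono) (auto simp: k_def)
    finally show ?thesis .
  qed simp
  also have "n * (n / d)\<^sup>2 / (\<epsilon> * n)\<^sup>2 = (sqrt n / d)\<^sup>2 / \<epsilon>\<^sup>2"
    using n by (simp add: power_divide power_mult_distrib)
  finally show ?thesis using assms by (simp add: divide_right_mono k_def)
qed

text \<open>
  Markov's inequality for \<open>n - P / n\<close>, where \<open>P\<close> is the number of connected low pairs. As each of the
  at most \<open>n\<close> low vertices is connected to at most \<open>c_max\<close> of them, \<open>P / n \<le> c_max\<close>. The hypothesis
  leaves room for the choice \<open>m = \<lceil>sqrt n\<rceil> \<le> n - d\<close> in the bound for the mean of \<open>P\<close>.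
\<close>

lemma prob_c_max_small:
  assumes d: "sqrt n + 1 \<le> real n - real d" and "\<epsilon> > 0"
  shows "measure_pmf.prob (random_tree n) {T. \<epsilon> < \<bar>real (c_max (n - d) T) / real n - 1\<bar>} \<le>
    4 * (d / sqrt n) / \<epsilon>"
proof -
  define k where "k = n - d"
  define m where "m = nat \<lceil>sqrt n\<rceil>"
  have "real n \<ge> 1" using d by (smt (verit) of_nat_0_le_iff real_sqrt_ge_zero)
  then have n: "real n > 0" "n \<ge> 1" and sq: "sqrt n > 0" "sqrt n \<le> n" and nn: "sqrt n * sqrt n = n"
    by (auto intro: real_sqrt_le_iff simp: real_le_lsqrt power2_eq_square)
  have "real d \<le> real n" using d sq by linarith
  then have nkd: "real n = real k + real d" by (simp add: k_def)
  have kn: "k \<le> n" by (simp add: k_def)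
  have "real m = of_int \<lceil>sqrt n\<rceil>" using sq by (simp add: m_def)
  then have m: "sqrt n \<le> m" "m \<le> sqrt n + 1" by linarith+
  have m0: "0 < m" "m \<le> k" using m sq d nkd by linarith+
  have event: "\<epsilon> * n \<le> n - card (low_conn k T) / n"
    if "\<epsilon> < \<bar>real (c_max k T) / real n - 1\<bar>" for T
  proof -
    have "c_max k T \<le> n" using c_max_le[of k T] kn by simp
    then have "real (c_max k T) / n \<le> 1" using n by simp
    then have "\<epsilon> < 1 - real (c_max k T) / n" using that by simp
    then have "\<epsilon> * n \<le> n - real (c_max k T)" using n by (simp add: field_simps)
    moreover have "card (low_conn k T) \<le> n * c_max k T"
      using card_low_conn_le[of k T] kn by (meson le_trans mult_le_mono1)
    then have "real (card (low_conn k T)) \<le> n * real (c_max k T)" by (metis of_nat_le_iff of_nat_mult)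
    then have "card (low_conn k T) / n \<le> real (c_max k T)" using n by (simp add: field_simps)
    ultimately show ?thesis by linarith
  qed
  have nonneg: "0 \<le> n - card (low_conn k T) / n" for T
  proof -
    have "card (low_conn k T) \<le> n * n"
      using card_low_conn_le[of k T] c_max_le[of k T] kn by (meson le_trans mult_le_mono)
    then have "real (card (low_conn k T)) \<le> n * real n" by (metis of_nat_le_iff of_nat_mult)
    then show ?thesis using n by (simp add: field_simps)
  qed
  have "measure_pmf.prob (random_tree n) {T. \<epsilon> < \<bar>real (c_max k T) / real n - 1\<bar>} \<le>
      measure_pmf.expectation (random_tree n) (\<lambda>T. n - card (low_conn k T) / n) / (\<epsilon> * n)"
    by (rule random_tree_Markov) (use n event nonneg assms in auto)
  also have "measure_pmf.expectation (random_tree n) (\<lambda>T. n - card (low_conn k T) / n) =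
      n - k * path_mean n k (k - 1) / n"
    using expectation_card_low_conn[OF n(2) kn] integrable_random_tree[OF n(2)]
    by (simp add: Bochner_Integration.integral_diff)
  also have "n - k * path_mean n k (k - 1) / n \<le> 4 * (d / sqrt n) * n"
  proof -
    define b where "b = d * (n / m + m)"
    have "n / m \<le> sqrt n"
    proof -
      have "n / m \<le> n / sqrt n" using m sq n m0 by (intro divide_left_mono) auto
      also have "\<dots> = sqrt n" by (simp add: real_div_sqrt)
      finally show ?thesis .
    qed
    then have b: "b \<le> d * (2 * sqrt n + 1)" "b \<ge> 0"
      unfolding b_def using m by (auto intro!: mult_left_mono)
    have "k * (n - b) \<le> k * path_mean n k (k - 1)"
      using path_mean_last_lower[OF m0 nkd] unfolding b_def by (intro mult_left_mono) auto
    moreover have "k * (n - b) = n * n - d * n - k * b" using nkd by (simp add: algebra_simps)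
    moreover have "k * b \<le> n * b" using b kn by (intro mult_right_mono) auto
    moreover have "n * b \<le> n * (d * (2 * sqrt n + 1))" using b by (intro mult_left_mono) auto
    ultimately have "n * n - k * path_mean n k (k - 1) \<le> d * n + n * (d * (2 * sqrt n + 1))"
      by linarith
    also have "\<dots> = n * (d * (2 * sqrt n + 2))" by (simp add: algebra_simps)
    also have "\<dots> \<le> n * (d * (4 * sqrt n))"
      using \<open>real n \<ge> 1\<close> by (intro mult_left_mono) auto
    finally have "(n * n - k * path_mean n k (k - 1)) / n \<le> d * (4 * sqrt n)"
      using n by (simp add: field_simps)
    moreover have "(n * n - k * path_mean n k (k - 1)) / n = n - k * path_mean n k (k - 1) / n"
      using n by (simp add: diff_divide_distrib)
    moreover have "4 * (d / sqrt n) * n = 4 * d * (n / sqrt n)"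
      by (simp only: times_divide_eq_left times_divide_eq_right mult.assoc)
    moreover have "n / sqrt n = sqrt n" by (simp add: real_div_sqrt)
    ultimately show ?thesis by (simp only: mult.left_commute mult.assoc)
  qed
  also have "4 * (d / sqrt n) * n / (\<epsilon> * n) = 4 * (d / sqrt n) / \<epsilon>"
    using n by simp
  finally show ?thesis using assms n by (simp add: divide_right_mono k_def)
qed

text \<open>
  Two different components are disjoint, so at most one of them has more than half of the vertices.
\<close>

lemma unique_giant:
  assumes "k \<le> n" "n \<ge> 1" "\<delta> < 1/2" "\<bar>real (c_max k T) / real n - 1\<bar> \<le> \<delta>"
  shows "\<exists>!C. C \<in> low_components k T \<and> \<bar>real (card C) / real n - 1\<bar> \<le> \<delta>"
proof -
  have "c_max k T \<noteq> 0"
  proof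
    assume "c_max k T = 0"
    then show False using assms(3,4) by simp
  qed
  then obtain C where C: "C \<in> low_components k T" "card C = c_max k T" using c_max_attained[of k T] by metis
  have half: "card D > n / 2" if "\<bar>real (card D) / real n - 1\<bar> \<le> \<delta>" for D :: "nat set"
  proof -
    have "real (card D) / real n > 1/2" using that assms by linarith
    then show ?thesis using assms by (simp add: field_simps)
  qed
  show ?thesis
  proof (rule ex1I[of _ C])
    fix D assume D: "D \<in> low_components k T \<and> \<bar>real (card D) / real n - 1\<bar> \<le> \<delta>"
    show "D = C"
    proof (rule ccontr)
      assume "D \<noteq> C"
      then have "D \<inter> C = {}"
        using quotient_disj[OF equiv_low_conn] D C(1) unfolding low_components_eq by blast
      moreover have sub: "D \<subseteq> {1..k}" "C \<subseteq> {1..k}" using D C low_component_subset by auto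
      ultimately have "card D + card C = card (D \<union> C)"
        by (metis card_Un_disjoint finite_atLeastAtMost finite_subset)
      also have "\<dots> \<le> k" using card_mono[of "{1..k}" "D \<union> C"] sub by simp
      finally have "real (card D) + real (card C) \<le> n" using assms(1) by linarith
      then show False using half[of D] half[of C] D C assms by auto
    qed
  qed (use C assms in auto)
qed

section \<open>The phase transition\<close>

lemma eventually_sqrt_room:
  assumes "(\<lambda>n. real (d n) / sqrt (real n)) \<longlonglongrightarrow> 0"
  shows "\<forall>\<^sub>F n in sequentially. sqrt (real n) + 1 \<le> real n - real (d n)"
proof -
  have "\<forall>\<^sub>F n in sequentially. real (d n) / sqrt (real n) < 1"
    using assms by (rule order_tendstoD) simp
  then show ?thesis using eventually_ge_at_top[of 9]
  proof eventually_elim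
    case (elim n)
    have "sqrt 9 \<le> sqrt (real n)" using elim by (intro real_sqrt_le_mono) simp
    then have s: "3 \<le> sqrt (real n)" by simp
    then have "3 * sqrt (real n) \<le> sqrt (real n) * sqrt (real n)" by (intro mult_right_mono) auto
    also have "\<dots> = real n" by simp
    finally have "3 * sqrt (real n) \<le> real n" .
    moreover have "real (d n) < sqrt (real n)" using elim s by (simp add: field_simps)
    ultimately show ?case using s by linarith
  qed
qed

theorem theorem12:
  fixes d :: "nat \<Rightarrow> nat"
  assumes "\<And>n. d n \<le> n"
  shows "((\<lambda>n. real (d n)) \<in> \<omega>(\<lambda>n. sqrt (real n)) \<longrightarrow>
           converges_in_prob random_tree (\<lambda>n T. real (c_max (n - d n) T) / real n) 0) \<and>
         ((\<lambda>n. real (d n)) \<in> o(\<lambda>n. sqrt (real n)) \<longrightarrow>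
           converges_in_prob random_tree (\<lambda>n T. real (c_max (n - d n) T) / real n) 1 \<and>
           (\<exists>\<delta> :: nat \<Rightarrow> real. \<delta> \<longlonglongrightarrow> 0 \<and>
             with_high_prob random_tree
               (\<lambda>n T. \<exists>!C. C \<in> low_components (n - d n) T \<and>
                           \<bar>real (card C) / real n - 1\<bar> \<le> \<delta> n)))"
proof (intro conjI impI)
  assume "(\<lambda>n. real (d n)) \<in> \<omega>(\<lambda>n. sqrt (real n))"
  then have o: "(\<lambda>n. sqrt (real n)) \<in> o(\<lambda>n. real (d n))" by (simp add: smallomega_iff_smallo)
  have lim: "(\<lambda>n. sqrt (real n) / real (d n)) \<longlonglongrightarrow> 0" by (rule smalloD_tendsto[OF o])
  have "\<forall>\<^sub>F n in sequentially. norm (sqrt (real n)) \<le> 1 * norm (real (d n))"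
    by (rule landau_o.smallD[OF o]) simp
  then have pos: "\<forall>\<^sub>F n in sequentially. 0 < d n"
    using eventually_ge_at_top[of 1] by eventually_elim (auto intro: Nat.gr0I)
  show "converges_in_prob random_tree (\<lambda>n T. real (c_max (n - d n) T) / real n) 0"
    unfolding converges_in_prob_def
  proof (intro allI impI)
    fix \<epsilon> :: real assume \<epsilon>: "\<epsilon> > 0"
    show "(\<lambda>n. measure_pmf.prob (random_tree n) {T. \<bar>real (c_max (n - d n) T) / real n - 0\<bar> > \<epsilon>}) \<longlonglongrightarrow> 0"
    proof (rule tendsto_sandwich[where f = "\<lambda>_. 0"])
      show "\<forall>\<^sub>F n in sequentially. measure_pmf.prob (random_tree n) {T. \<bar>real (c_max (n - d n) T) / real n - 0\<bar> > \<epsilon>} \<le>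
        (sqrt (real n) / real (d n))\<^sup>2 / \<epsilon>\<^sup>2"
        using pos eventually_ge_at_top[of 1]
      proof eventually_elim
        case (elim n)
        then show ?case using prob_c_max_large[of n "d n" \<epsilon>] assms \<epsilon> by simp
      qed
      show "(\<lambda>n. (sqrt (real n) / real (d n))\<^sup>2 / \<epsilon>\<^sup>2) \<longlonglongrightarrow> 0"
        using tendsto_divide[OF tendsto_power[OF lim, of 2] tendsto_const[of "\<epsilon>\<^sup>2"]] \<epsilon> by simp
    qed (auto intro: always_eventually)
  qed
next
  assume o: "(\<lambda>n. real (d n)) \<in> o(\<lambda>n. sqrt (real n))"
  have lim: "(\<lambda>n. real (d n) / sqrt (real n)) \<longlonglongrightarrow> 0" by (rule smalloD_tendsto[OF o])
  note room = eventually_sqrt_room[OF lim]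
  show "converges_in_prob random_tree (\<lambda>n T. real (c_max (n - d n) T) / real n) 1"
    unfolding converges_in_prob_def
  proof (intro allI impI)
    fix \<epsilon> :: real assume \<epsilon>: "\<epsilon> > 0"
    show "(\<lambda>n. measure_pmf.prob (random_tree n) {T. \<bar>real (c_max (n - d n) T) / real n - 1\<bar> > \<epsilon>}) \<longlonglongrightarrow> 0"
    proof (rule tendsto_sandwich[where f = "\<lambda>_. 0"])
      show "\<forall>\<^sub>F n in sequentially. measure_pmf.prob (random_tree n) {T. \<bar>real (c_max (n - d n) T) / real n - 1\<bar> > \<epsilon>} \<le>
        4 * (real (d n) / sqrt (real n)) / \<epsilon>"
        using room by eventually_elim (rule prob_c_max_small[OF _ \<epsilon>])
      show "(\<lambda>n. 4 * (real (d n) / sqrt (real n)) / \<epsilon>) \<longlonglongrightarrow> 0"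
        using tendsto_divide[OF tendsto_mult[OF tendsto_const[of 4] lim] tendsto_const[of \<epsilon>]] \<epsilon> by simp
    qed (auto intro: always_eventually)
  qed
  \<comment> \<open>The square root makes the bound of \<open>prob_c_max_small\<close> at \<open>\<epsilon> = \<delta> n\<close> at most \<open>\<delta> n\<close>;
      the term \<open>1 / n\<close> keeps \<open>\<delta> n\<close> positive where \<open>d n = 0\<close>.\<close>
  define \<delta> where "\<delta> = (\<lambda>n. sqrt (4 * (real (d n) / sqrt (real n)) + 1 / real n))"
  have lim\<delta>: "\<delta> \<longlonglongrightarrow> 0"
  proof -
    have "(\<lambda>n. 4 * (real (d n) / sqrt (real n)) + 1 / real n) \<longlonglongrightarrow> 4 * 0 + 0"
      by (intro tendsto_intros lim lim_1_over_n)
    from tendsto_real_sqrt[OF this] show ?thesis by (simp add: \<delta>_def)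
  qed
  have half: "\<forall>\<^sub>F n in sequentially. \<delta> n < 1/2" using lim\<delta> by (rule order_tendstoD) simp
  show "\<exists>\<delta> :: nat \<Rightarrow> real. \<delta> \<longlonglongrightarrow> 0 \<and> with_high_prob random_tree
     (\<lambda>n T. \<exists>!C. C \<in> low_components (n - d n) T \<and> \<bar>real (card C) / real n - 1\<bar> \<le> \<delta> n)"
  proof (intro exI[of _ \<delta>] conjI lim\<delta>)
    let ?U = "\<lambda>n. {T. \<exists>!C. C \<in> low_components (n - d n) T \<and> \<bar>real (card C) / real n - 1\<bar> \<le> \<delta> n}"
    show "with_high_prob random_tree
     (\<lambda>n T. \<exists>!C. C \<in> low_components (n - d n) T \<and> \<bar>real (card C) / real n - 1\<bar> \<le> \<delta> n)"
      unfolding with_high_prob_def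
    proof (rule tendsto_sandwich[where h = "\<lambda>_. 1"])
      show "\<forall>\<^sub>F n in sequentially. 1 - \<delta> n \<le> measure_pmf.prob (random_tree n) (?U n)"
        using room half eventually_ge_at_top[of 1]
      proof eventually_elim
        case (elim n)
        let ?B = "{T. \<delta> n < \<bar>real (c_max (n - d n) T) / real n - 1\<bar>}"
        have sub: "- ?B \<subseteq> ?U n"
        proof
          fix T assume "T \<in> - ?B"
          then have "\<bar>real (c_max (n - d n) T) / real n - 1\<bar> \<le> \<delta> n" by auto
          from unique_giant[OF diff_le_self elim(3,2) this] show "T \<in> ?U n" by simp
        qed
        have sq: "(\<delta> n)\<^sup>2 = 4 * (real (d n) / sqrt (real n)) + 1 / real n"
          unfolding \<delta>_def by (intro real_sqrt_pow2) simp
        have pos: "\<delta> n > 0" unfolding \<delta>_def using elim(3) by (intro real_sqrt_gt_zero add_nonneg_pos) auto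
        have "measure_pmf.prob (random_tree n) ?B \<le> 4 * (real (d n) / sqrt (real n)) / \<delta> n"
          by (rule prob_c_max_small[OF elim(1) pos])
        also have "\<dots> \<le> (\<delta> n)\<^sup>2 / \<delta> n" using pos unfolding sq by (intro divide_right_mono) auto
        also have "\<dots> = \<delta> n" using pos by (simp add: power2_eq_square)
        finally have "measure_pmf.prob (random_tree n) (- ?B) \<ge> 1 - \<delta> n"
          using measure_pmf.prob_compl[of ?B "random_tree n"] by (simp add: Compl_eq_Diff_UNIV)
        also have "measure_pmf.prob (random_tree n) (- ?B) \<le> measure_pmf.prob (random_tree n) (?U n)"
          by (rule measure_pmf.finite_measure_mono[OF sub]) simp
        finally show ?case .
      qed
      show "(\<lambda>n. 1 - \<delta> n) \<longlonglongrightarrow> 1" using tendsto_diff[OF tendsto_const[of 1] lim\<delta>] by simp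
    qed (auto intro: always_eventually)
  qed
qed

end
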